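(* Let $\alpha\geq 0$ and let $G$ be an $\alpha$-greedy orientable graph, and let $k\geq\alpha+\chi(G)$ be an integer. Then for every subgraph $H$ of $\overline{G}$, $$m(G,H,k)\leq\frac{|E(H)|}{k-\chi(G)+1-\alpha}.$$
   Context: All graphs are finite, simple and unweighted; $\overline{G}$ is the complement of $G$ and $\chi(G)$ its chromatic number. A $k$-coloring of $G$ is a map $\phi:V(G)\to\{1,\dots,k\}$ with $\phi(u)\neq\phi(v)$ for every edge $uv$ of $G$; for a subgraph $H$ of $\overline{G}$ an edge $uv$ of $H$ is monochromatic if $\phi(u)=\phi(v)$, and for $k\geq\chi(G)$, $m(G,H,k)$ is the minimum over all $k$-colorings of $G$ of the number of monochromatic edges of $H$. Given an ordering of $V(G)$, orient each edge $uv$ from $u$ to $v$ when $u$ precedes $v$; let $\Delta^{-}(\overrightarrow{G})$ be the maximum in-degree of the resulting oriented graph (i.e. the maximum over $v$ of the number of neighbours of $v$ preceding $v$). $G$ is $\alpha$-greedy orientable ($\alpha\ge 0$) if there is an ordering of $V(G)$ with $\Delta^{-}(\overrightarrow{G})=\chi(G)-1+\alpha$. *)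

theory Defs
  imports Complex_Main "HOL-Library.FuncSet"
begin

record 'a sgraph =
  verts :: "'a set"
  edges :: "'a set set"

definition simple_graph :: "'a sgraph \<Rightarrow> bool" where
  "simple_graph G \<longleftrightarrow> finite (verts G) \<and> (\<forall>e \<in> edges G. e \<subseteq> verts G \<and> card e = 2)"

definition complement_graph :: "'a sgraph \<Rightarrow> 'a sgraph" where
  "complement_graph G =
     \<lparr>verts = verts G, edges = {e. e \<subseteq> verts G \<and> card e = 2} - edges G\<rparr>"

definition is_subgraph :: "'a sgraph \<Rightarrow> 'a sgraph \<Rightarrow> bool" where
  "is_subgraph H G \<longleftrightarrow> simple_graph H \<and> verts H \<subseteq> verts G \<and> edges H \<subseteq> edges G"

(* Colorings are extensional functions, so that they correspond one-to-one to
   maps defined on the vertex set only; in particular there are finitely many. *)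
definition colorings :: "'a sgraph \<Rightarrow> nat \<Rightarrow> ('a \<Rightarrow> nat) set" where
  "colorings G k =
     {\<phi> \<in> verts G \<rightarrow>\<^sub>E {1..k}. \<forall>u v. {u, v} \<in> edges G \<longrightarrow> \<phi> u \<noteq> \<phi> v}"

definition chromatic_number :: "'a sgraph \<Rightarrow> nat" where
  "chromatic_number G = (LEAST k. colorings G k \<noteq> {})"

definition mono_edges :: "'a sgraph \<Rightarrow> ('a \<Rightarrow> nat) \<Rightarrow> 'a set set" where
  "mono_edges H \<phi> = {e \<in> edges H. \<exists>u v. e = {u, v} \<and> \<phi> u = \<phi> v}"

(* Only meaningful for k at least the chromatic number of G: otherwise the
   minimum is taken over the empty set. *)
definition min_mono :: "'a sgraph \<Rightarrow> 'a sgraph \<Rightarrow> nat \<Rightarrow> nat" where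
  "min_mono G H k = Min ((\<lambda>\<phi>. card (mono_edges H \<phi>)) ` colorings G k)"

definition orientation :: "'a sgraph \<Rightarrow> 'a rel \<Rightarrow> 'a rel" where
  "orientation G r = {(u, v). {u, v} \<in> edges G \<and> (u, v) \<in> r \<and> u \<noteq> v}"

(* Inserting 0 only matters for the graph without vertices, whose maximum
   in-degree is thereby 0. *)
definition max_in_degree :: "'a set \<Rightarrow> 'a rel \<Rightarrow> nat" where
  "max_in_degree V D = Max (insert 0 ((\<lambda>v. card {u. (u, v) \<in> D}) ` V))"

definition greedy_orientable :: "real \<Rightarrow> 'a sgraph \<Rightarrow> bool" where
  "greedy_orientable \<alpha> G \<longleftrightarrow>
     (\<exists>r. linear_order_on (verts G) r \<and>
        real (max_in_degree (verts G) (orientation G r)) = real (chromatic_number G) - 1 + \<alpha>)"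

end

theory Submission imports Defs begin

text \<open>Colour the vertices greedily along the given ordering. If \<open>d\<close> is the maximum in-degree, each
  vertex has at least \<open>k - d\<close> colours not used on its earlier \<open>G\<close>-neighbours. These colours
  partition part of its earlier \<open>H\<close>-neighbours, so some colour makes at most a fraction
  \<open>1 / (k - d)\<close> of the backward \<open>H\<close>-edges monochromatic. Summing over all vertices gives the bound,
  since \<open>k - d = k - \<chi>(G) + 1 - \<alpha>\<close>.\<close>

lemma finite_linear_order_has_greatest:
  assumes "finite S" "S \<noteq> {}" "S \<subseteq> V" "linear_order_on V r"
  shows "\<exists>m\<in>S. \<forall>u\<in>S. (u, m) \<in> r"
proof -
  have r: "refl_on V r" "trans r" "total_on V r"
    using assms(4) by (auto simp: order_on_defs)
  show ?thesis
    using assms(1-3)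
  proof (induction S rule: finite_ne_induct)
    case (singleton x)
    then show ?case using r(1) by (auto dest: refl_onD)
  next
    case (insert x F)
    then obtain m where m: "m \<in> F" "\<forall>u\<in>F. (u, m) \<in> r" by auto
    have "x \<in> V" "m \<in> V" "x \<noteq> m" using insert m by auto
    then consider "(x, m) \<in> r" | "(m, x) \<in> r"
      using r(3) by (auto simp: total_on_def)
    then show ?case
    proof cases
      case 1
      then show ?thesis using m by auto
    next
      case 2
      then have "(u, x) \<in> r" if "u \<in> F" for u
        using m(2) that r(2) by (meson transD)
      then show ?thesis using r(1) \<open>x \<in> V\<close> by (auto dest: refl_onD)
    qed
  qed
qed

text \<open>The minimum of \<open>f\<close> on \<open>A\<close> is at most its average. Multiplying
  out keeps everything in the natural numbers; in the application \<open>A\<close> is the set of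
  free colours and \<open>n\<close> is \<open>k - d\<close>.\<close>

lemma exists_below_average:
  fixes f :: "'b \<Rightarrow> nat"
  assumes "finite A" "A \<noteq> {}" "n \<le> card A" "sum f A \<le> t"
  shows "\<exists>c\<in>A. n * f c \<le> t"
proof -
  have "Min (f ` A) \<in> f ` A" using assms by (intro Min_in) auto
  then obtain c where c: "c \<in> A" "f c = Min (f ` A)" by auto
  have "card A * f c \<le> sum f A"
    using sum_bounded_below[of A "f c" f] c assms(1) by simp
  moreover have "n * f c \<le> card A * f c" using assms(3) by simp
  ultimately show ?thesis using c(1) assms(4) by (meson le_trans)
qed

text \<open>Greedy colouring as an induction that deletes from each nonempty set a vertex with at
  most \<open>d\<close> neighbours in that set and colours this vertex last. Stating the hypothesis
  for all subsets removes the ordering from the induction. \<open>F\<close> stays fixed while the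
  vertex set shrinks, so its edges are counted only when contained in the current set.\<close>

lemma degenerate_coloring_few_mono:
  fixes E F :: "'a set set"
  assumes "finite V" "d < k" "finite F"
    and F2: "\<And>e. e \<in> F \<Longrightarrow> card e = 2"
    and degen: "\<And>S. S \<subseteq> V \<Longrightarrow> S \<noteq> {} \<Longrightarrow> \<exists>v\<in>S. card {u \<in> S. u \<noteq> v \<and> {u, v} \<in> E} \<le> d"
  shows "\<exists>\<phi>\<in>V \<rightarrow>\<^sub>E {1..k}. (\<forall>u\<in>V. \<forall>v\<in>V. u \<noteq> v \<longrightarrow> {u, v} \<in> E \<longrightarrow> \<phi> u \<noteq> \<phi> v) \<and>
    (k - d) * card {e \<in> F. e \<subseteq> V \<and> (\<exists>u v. e = {u, v} \<and> \<phi> u = \<phi> v)} \<le> card {e \<in> F. e \<subseteq> V}"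
  using assms(1)
proof (induction V rule: finite_remove_induct)
  case empty
  \<comment> \<open>No pair \<open>{u, v}\<close> is contained in the empty set.\<close>
  have "{e \<in> F. e \<subseteq> {} \<and> (\<exists>u v. e = {u, v} \<and> \<phi> u = \<phi> v)} = {}" for \<phi> :: "'a \<Rightarrow> nat"
    by auto
  then show ?case
    unfolding PiE_empty_domain by (simp only: card.empty mult_0_right) simp
next
  case (remove S)
  obtain v where v: "v \<in> S" "card {u \<in> S. u \<noteq> v \<and> {u, v} \<in> E} \<le> d"
    using degen[of S] remove by blast
  define T where "T = S - {v}"
  have T: "S = insert v T" "v \<notin> T" "finite T" using v remove by (auto simp: T_def)
  define mono where
    "mono \<psi> W = {e \<in> F. e \<subseteq> W \<and> (\<exists>u v. e = {u, v} \<and> \<psi> u = \<psi> v)}" for \<psi> :: "'a \<Rightarrow> nat" and W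
  obtain \<phi> where \<phi>: "\<phi> \<in> T \<rightarrow>\<^sub>E {1..k}"
      "\<forall>u\<in>T. \<forall>v\<in>T. u \<noteq> v \<longrightarrow> {u, v} \<in> E \<longrightarrow> \<phi> u \<noteq> \<phi> v"
      "(k - d) * card (mono \<phi> T) \<le> card {e \<in> F. e \<subseteq> T}"
    using remove.IH[OF v(1)] unfolding T_def mono_def by blast
  define N where "N = {u \<in> T. {u, v} \<in> E}"
  have "N = {u \<in> S. u \<noteq> v \<and> {u, v} \<in> E}" by (auto simp: N_def T_def)
  then have "card N \<le> d" using v(2) by simp
  have "finite N" using T(3) by (simp add: N_def)
  \<comment> \<open>The colours allowed at \<open>v\<close>: the at most \<open>d\<close> neighbours
    in \<open>N\<close> forbid at most \<open>d\<close> of the \<open>k\<close> colours.\<close>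
  define A where "A = {1..k} - \<phi> ` N"
  have "card (\<phi> ` N) \<le> d" using card_image_le[OF \<open>finite N\<close>, of \<phi>] \<open>card N \<le> d\<close> by linarith
  then have A: "k - d \<le> card A" "finite A"
    using diff_card_le_card_Diff[of "\<phi> ` N" "{1..k}"] \<open>finite N\<close> by (auto simp: A_def)
  then have "A \<noteq> {}" using \<open>d < k\<close> by auto
  define M where "M c = {u \<in> T. {u, v} \<in> F \<and> \<phi> u = c}" for c
  define B where "B = {u \<in> T. {u, v} \<in> F}"
  have fin: "finite (M c)" "finite B" for c using T(3) by (auto simp: M_def B_def)
  \<comment> \<open>Each \<open>F\<close>-neighbour of \<open>v\<close> in \<open>T\<close> has just
    one colour, so the classes \<open>M c\<close> are disjoint parts of \<open>B\<close>, and
    averaging over \<open>A\<close> yields a colour with a small class.\<close>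
  have "(\<Sum>c\<in>A. card (M c)) = card (\<Union>c\<in>A. M c)"
    using A(2) fin by (subst card_UN_disjoint) (auto simp: M_def)
  also have "\<dots> \<le> card B"
    using fin by (intro card_mono) (auto simp: M_def B_def)
  finally obtain c where c: "c \<in> A" "(k - d) * card (M c) \<le> card B"
    using exists_below_average[OF A(2) \<open>A \<noteq> {}\<close> A(1)] by blast
  define \<psi> where "\<psi> = \<phi>(v := c)"
  \<comment> \<open>A monochromatic edge avoiding \<open>v\<close> was monochromatic before; one
    through \<open>v\<close> has its other end coloured \<open>c\<close>.\<close>
  have "mono \<psi> S \<subseteq> mono \<phi> T \<union> (\<lambda>u. {u, v}) ` M c"
  proof
    fix e assume "e \<in> mono \<psi> S"
    then obtain x y where e: "e \<in> F" "e \<subseteq> S" "e = {x, y}" "\<psi> x = \<psi> y"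
      by (auto simp: mono_def)
    have "x \<noteq> y" using F2[OF e(1)] e(3) by auto
    show "e \<in> mono \<phi> T \<union> (\<lambda>u. {u, v}) ` M c"
    proof (cases "v \<in> e")
      case True
      then obtain u where u: "e = {u, v}" "u \<noteq> v" "\<psi> u = \<psi> v"
        using e(3,4) \<open>x \<noteq> y\<close> by (metis doubleton_eq_iff empty_iff insertE)
      then have "u \<in> M c" using e(1,2) by (auto simp: M_def \<psi>_def T_def)
      then show ?thesis using u by blast
    next
      case False
      then have "e \<subseteq> T" "\<phi> x = \<phi> y" using e by (auto simp: \<psi>_def T_def)
      then show ?thesis using e by (auto simp: mono_def)
    qed
  qed
  moreover have "finite (mono \<phi> T)" using \<open>finite F\<close> by (simp add: mono_def)
  ultimately have "card (mono \<psi> S) \<le> card (mono \<phi> T \<union> (\<lambda>u. {u, v}) ` M c)"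
    using fin by (intro card_mono) auto
  also have "\<dots> \<le> card (mono \<phi> T) + card (M c)"
    by (meson add_left_mono card_Un_le card_image_le fin(1) le_trans)
  finally have "(k - d) * card (mono \<psi> S) \<le> (k - d) * card (mono \<phi> T) + (k - d) * card (M c)"
    by (metis distrib_left mult_le_mono2)
  also have "\<dots> \<le> card {e \<in> F. e \<subseteq> T} + card B"
    using \<phi>(3) c(2) by simp
  \<comment> \<open>\<open>B\<close> counts the edges of \<open>F\<close> joining \<open>v\<close>
    to \<open>T\<close>. They are distinct from those inside \<open>T\<close>, so the two bounds add
    up to at most the number of edges inside \<open>S\<close>.\<close>
  also have "card B = card ((\<lambda>u. {u, v}) ` B)"
    by (rule card_image[symmetric]) (auto simp: inj_on_def doubleton_eq_iff)
  also have "card {e \<in> F. e \<subseteq> T} + \<dots> = card ({e \<in> F. e \<subseteq> T} \<union> (\<lambda>u. {u, v}) ` B)"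
    using \<open>finite F\<close> fin T(2) by (intro card_Un_disjoint[symmetric]) auto
  also have "\<dots> \<le> card {e \<in> F. e \<subseteq> S}"
    using \<open>finite F\<close> T(1) by (intro card_mono) (auto simp: B_def)
  finally have "(k - d) * card (mono \<psi> S) \<le> card {e \<in> F. e \<subseteq> S}" .
  moreover have "\<psi> \<in> S \<rightarrow>\<^sub>E {1..k}"
    using \<phi>(1) c(1) T(1) unfolding \<psi>_def A_def by (auto simp: PiE_iff extensional_def)
  moreover have "\<psi> x \<noteq> \<psi> y" if "x \<in> S" "y \<in> S" "x \<noteq> y" "{x, y} \<in> E" for x y
  proof -
    have c_free: "\<phi> u \<noteq> c" if "u \<in> T" "{u, v} \<in> E" for u
      using c(1) that by (auto simp: A_def N_def)
    show ?thesis
      using that \<phi>(2) c_free[of x] c_free[of y] T(1)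
      by (auto simp: \<psi>_def insert_commute)
  qed
  ultimately show ?case unfolding mono_def by blast
qed

text \<open>Take the last vertex of \<open>S\<close> in the order: all its neighbours in
  \<open>S\<close> precede it, so its in-degree counts them.\<close>

lemma max_in_degree_degenerate:
  assumes "simple_graph G" "linear_order_on (verts G) r" "S \<subseteq> verts G" "S \<noteq> {}"
  shows "\<exists>v\<in>S. card {u \<in> S. u \<noteq> v \<and> {u, v} \<in> edges G}
    \<le> max_in_degree (verts G) (orientation G r)"
proof -
  have fin: "finite (verts G)" using assms(1) by (simp add: simple_graph_def)
  obtain m where m: "m \<in> S" "\<forall>u\<in>S. (u, m) \<in> r"
    using finite_linear_order_has_greatest[OF _ assms(4,3,2)] fin assms(3) finite_subset by blast
  \<comment> \<open>This makes the in-neighbourhood finite, as monotonicity of \<open>card\<close>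
    requires: an infinite set would have \<open>card\<close> 0.\<close>
  have "{u. (u, m) \<in> orientation G r} \<subseteq> verts G"
    using assms(1) by (auto simp: simple_graph_def orientation_def)
  then have "card {u \<in> S. u \<noteq> m \<and> {u, m} \<in> edges G} \<le> card {u. (u, m) \<in> orientation G r}"
    using m fin by (intro card_mono) (auto simp: orientation_def intro: finite_subset)
  also have "\<dots> \<le> max_in_degree (verts G) (orientation G r)"
    unfolding max_in_degree_def using fin m(1) assms(3) by (intro Max_ge) auto
  finally show ?thesis using m(1) by blast
qed

lemma finite_colorings: "finite (verts G) \<Longrightarrow> finite (colorings G k)"
  unfolding colorings_def by (rule finite_subset[of _ "verts G \<rightarrow>\<^sub>E {1..k}"]) (auto intro: finite_PiE)

theorem theorem9:
  fixes G :: "'a sgraph" and \<alpha> :: real and k :: nat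
  assumes "simple_graph G"
    and "\<alpha> \<ge> 0"
    and "greedy_orientable \<alpha> G"
    and "real k \<ge> \<alpha> + real (chromatic_number G)"
  shows "\<forall>H. is_subgraph H (complement_graph G) \<longrightarrow>
           real (min_mono G H k)
             \<le> real (card (edges H)) / (real k - real (chromatic_number G) + 1 - \<alpha>)"
proof (intro allI impI)
  fix H :: "'a sgraph"
  assume "is_subgraph H (complement_graph G)"
  then have H: "\<forall>e\<in>edges H. e \<subseteq> verts G \<and> card e = 2"
    by (auto simp: is_subgraph_def complement_graph_def)
  have G: "finite (verts G)" "\<forall>e\<in>edges G. e \<subseteq> verts G \<and> card e = 2"
    using assms(1) by (auto simp: simple_graph_def)
  have finH: "finite (edges H)"
    using H G(1) by (intro finite_subset[of "edges H" "Pow (verts G)"]) auto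
  obtain r where r: "linear_order_on (verts G) r"
    and d: "real (max_in_degree (verts G) (orientation G r)) = real (chromatic_number G) - 1 + \<alpha>"
    using assms(3) by (auto simp: greedy_orientable_def)
  define d where "d = max_in_degree (verts G) (orientation G r)"
  \<comment> \<open>Indeed \<open>d\<close> equals the chromatic number minus 1 plus \<alpha>, which
    is at most \<open>k - 1\<close>. So the natural subtraction \<open>k - d\<close> is not
    truncated, and the denominator is positive.\<close>
  have "d < k" using d assms(4) by (simp add: d_def)
  have "real (k - d) = real k - real (chromatic_number G) + 1 - \<alpha>"
    using d \<open>d < k\<close> by (simp add: d_def of_nat_diff)
  obtain \<phi> where \<phi>: "\<phi> \<in> verts G \<rightarrow>\<^sub>E {1..k}"
      "\<forall>u\<in>verts G. \<forall>v\<in>verts G. u \<noteq> v \<longrightarrow> {u, v} \<in> edges G \<longrightarrow> \<phi> u \<noteq> \<phi> v"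
      "(k - d) * card {e \<in> edges H. e \<subseteq> verts G \<and> (\<exists>u v. e = {u, v} \<and> \<phi> u = \<phi> v)}
        \<le> card {e \<in> edges H. e \<subseteq> verts G}"
    using degenerate_coloring_few_mono[OF G(1) \<open>d < k\<close> finH, of "edges G"] H
      max_in_degree_degenerate[OF assms(1) r] unfolding d_def by blast
  \<comment> \<open>\<open>colorings\<close> quantifies over all \<open>u\<close> and
    \<open>v\<close>, whereas \<phi> is known to be proper only for distinct vertices of
    \<open>G\<close>; edges of cardinality 2 bridge the gap.\<close>
  have "u \<in> verts G \<and> v \<in> verts G \<and> u \<noteq> v" if "{u, v} \<in> edges G" for u v
    using G(2) that by fastforce
  then have "\<phi> \<in> colorings G k"
    using \<phi>(1,2) by (auto simp: colorings_def)
  then have le: "min_mono G H k \<le> card (mono_edges H \<phi>)"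
    unfolding min_mono_def using finite_colorings[OF G(1)] by (intro Min_le) auto
  have "{e \<in> edges H. e \<subseteq> verts G \<and> (\<exists>u v. e = {u, v} \<and> \<phi> u = \<phi> v)} = mono_edges H \<phi>"
    "{e \<in> edges H. e \<subseteq> verts G} = edges H"
    using H by (auto simp: mono_edges_def)
  then have "(k - d) * card (mono_edges H \<phi>) \<le> card (edges H)"
    using \<phi>(3) by simp
  then have "(k - d) * min_mono G H k \<le> card (edges H)"
    using le by (meson le_trans mult_le_mono2)
  then have "real (k - d) * real (min_mono G H k) \<le> real (card (edges H))"
    by (metis of_nat_le_iff of_nat_mult)
  then have "real (min_mono G H k) \<le> real (card (edges H)) / real (k - d)"
    using \<open>d < k\<close> by (simp add: pos_le_divide_eq mult.commute)
  then show "real (min_mono G H k)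
      \<le> real (card (edges H)) / (real k - real (chromatic_number G) + 1 - \<alpha>)"
    using \<open>real (k - d) = _\<close> by simp
qed

end
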